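(* For every integer $p\geq 3$ there exists a $(p,p)$-form $\alpha$ in $\mathbb C^{2p}$ such that $\alpha\geq 0$ but $\alpha^2<0$, i.e. $\alpha\wedge\alpha=c\,dV$ with $c<0$, where $dV=idz_1\wedge d\bar z_1\wedge\dots\wedge idz_{2p}\wedge d\bar z_{2p}$.
   Context: Forms are constant-coefficient forms on $\mathbb C^n$. A $(p,p)$-form $\alpha$ in $\mathbb C^n$ is called positive (written $\alpha\geq 0$) if for all $(1,0)$-forms $\gamma_1,\dots,\gamma_{n-p}\in(\mathbb C^n)^\ast$ one has $\alpha\wedge i\gamma_1\wedge\bar\gamma_1\wedge\dots\wedge i\gamma_{n-p}\wedge\bar\gamma_{n-p}\geq 0$, meaning this $(n,n)$-form is a nonnegative real multiple of the standard volume form $idz_1\wedge d\bar z_1\wedge\dots\wedge idz_n\wedge d\bar z_n$. *)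

theory Defs
  imports Complex_Main
begin

text \<open>Constant-coefficient complex forms on C^n.  The exterior algebra of the real
cotangent space (complexified) is spanned by the 2n one-forms
dz_0,...,dz_{n-1}, dzbar_0,...,dzbar_{n-1}; we index them by 0..2n-1 with
dz_j = e_j and dzbar_j = e_{n+j}.  A form is a coefficient function on finite
sets K of indices, the coefficient of e_K = e_{k_1} wedge ... wedge e_{k_m} with
k_1 < ... < k_m.\<close>

type_synonym form = "nat set \<Rightarrow> complex"

text \<open>Wedge product: e_S wedge e_T = (-1)^(number of pairs s in S, t in T, t < s) e_(S union T)
for disjoint S, T, and 0 otherwise.\<close>
definition wedge :: "form \<Rightarrow> form \<Rightarrow> form" where
  "wedge a b K = (\<Sum>S\<in>Pow K.
      (-1) ^ card {(s,t). s \<in> S \<and> t \<in> K - S \<and> t < s} * a S * b (K - S))"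

definition one_form :: form where
  "one_form K = (if K = {} then 1 else 0)"

definition scale_form :: "complex \<Rightarrow> form \<Rightarrow> form" where
  "scale_form c a = (\<lambda>K. c * a K)"

fun wedge_list :: "form list \<Rightarrow> form" where
  "wedge_list [] = one_form"
| "wedge_list (a # as) = wedge a (wedge_list as)"

definition dz :: "nat \<Rightarrow> form" where
  "dz j = (\<lambda>K. if K = {j} then 1 else 0)"

definition dzbar :: "nat \<Rightarrow> nat \<Rightarrow> form" where
  "dzbar n j = (\<lambda>K. if K = {n + j} then 1 else 0)"

definition oneform10 :: "nat \<Rightarrow> (nat \<Rightarrow> complex) \<Rightarrow> form" where
  "oneform10 n c = (\<lambda>K. \<Sum>j<n. c j * dz j K)"

definition conj_oneform10 :: "nat \<Rightarrow> (nat \<Rightarrow> complex) \<Rightarrow> form" where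
  "conj_oneform10 n c = (\<lambda>K. \<Sum>j<n. cnj (c j) * dzbar n j K)"

definition i_gamma_gammabar :: "nat \<Rightarrow> (nat \<Rightarrow> complex) \<Rightarrow> form" where
  "i_gamma_gammabar n c = scale_form \<i> (wedge (oneform10 n c) (conj_oneform10 n c))"

definition dV :: "nat \<Rightarrow> form" where
  "dV n = wedge_list (map (\<lambda>j. scale_form \<i> (wedge (dz j) (dzbar n j))) [0..<n])"

definition is_pq_form :: "nat \<Rightarrow> nat \<Rightarrow> nat \<Rightarrow> form \<Rightarrow> bool" where
  "is_pq_form n p q a \<longleftrightarrow> (\<forall>K. a K \<noteq> 0 \<longrightarrow>
      K \<subseteq> {..<2*n} \<and> card (K \<inter> {..<n}) = p \<and> card (K \<inter> {n..<2*n}) = q)"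

definition nonneg_top :: "nat \<Rightarrow> form \<Rightarrow> bool" where
  "nonneg_top n b \<longleftrightarrow> (\<exists>c::real. c \<ge> 0 \<and> b = scale_form (complex_of_real c) (dV n))"

definition positive_form :: "nat \<Rightarrow> nat \<Rightarrow> form \<Rightarrow> bool" where
  "positive_form n p a \<longleftrightarrow> (\<forall>gs :: (nat \<Rightarrow> complex) list. length gs = n - p \<longrightarrow>
      nonneg_top n (wedge a (wedge_list (map (i_gamma_gammabar n) gs))))"

end

theory Submission
  imports Defs
begin

text \<open>A (p,p)-form on C^{2p} is a Hermitian form H on the p-vectors, and it is positive iff H is
  nonnegative on decomposable ones, i.e. on vectors of Pluecker coordinates.  For p = 3 put
  X = {0,1,2}, Y = {3,4,5} and let H have diagonal entries 3 at X and Y and 1 at the other eighteen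
  triples, and off-diagonal entry 6 between X and Y.  The Pluecker relations exchanging one element
  of X against Y bound three times the product of the coordinates at X and Y by the sum over the
  nine remaining complementary pairs, so AM-GM yields positivity.  As p is odd, the off-diagonal
  entries enter the square with a negative sign: it is 2 * 9 + 18 - 2 * 36 = -36.
  For p > 3 this form is multiplied by the strongly positive (p-3,p-3)-form
  \<omega>^{p-3} / (p-3)!, with \<omega> the standard Kaehler form in the variables of index at least 6.\<close>

subsection \<open>Inversions and the wedge product\<close>

text \<open>The exponent of the sign in \<open>wedge\<close>, with the second set freed from being a
  complement so that additivity in both arguments can be stated.\<close>

definition invs :: "nat set \<Rightarrow> nat set \<Rightarrow> nat" where
  "invs A C = card {(s,t). s \<in> A \<and> t \<in> C \<and> t < s}"

lemma finite_invs_set: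
  fixes A C :: "nat set"
  assumes "finite A"
  shows "finite {(s,t). s \<in> A \<and> t \<in> C \<and> t < s}"
proof (rule finite_subset)
  show "{(s,t). s \<in> A \<and> t \<in> C \<and> t < s} \<subseteq> Sigma A (\<lambda>s. {..<s})" by auto
qed (use assms in auto)

lemma invs_Un_left:
  assumes "finite A" "finite B" "A \<inter> B = {}"
  shows "invs (A \<union> B) C = invs A C + invs B C"
proof -
  have "{(s,t). s \<in> A \<union> B \<and> t \<in> C \<and> t < s}
      = {(s,t). s \<in> A \<and> t \<in> C \<and> t < s} \<union> {(s,t). s \<in> B \<and> t \<in> C \<and> t < s}"
    by auto
  then show ?thesis unfolding invs_def
    using assms by (subst card_Un_disjoint[symmetric]) (auto intro: finite_invs_set)
qed

lemma invs_Un_right: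
  assumes "finite A" "C \<inter> D = {}"
  shows "invs A (C \<union> D) = invs A C + invs A D"
proof -
  have "{(s,t). s \<in> A \<and> t \<in> C \<union> D \<and> t < s}
      = {(s,t). s \<in> A \<and> t \<in> C \<and> t < s} \<union> {(s,t). s \<in> A \<and> t \<in> D \<and> t < s}"
    by auto
  then show ?thesis unfolding invs_def
    using assms by (subst card_Un_disjoint[symmetric]) (auto intro: finite_invs_set)
qed

lemma invs_shift: "invs ((+) n ` A) ((+) n ` C) = invs A C"
proof -
  have "{(s,t). s \<in> (+) n ` A \<and> t \<in> (+) n ` C \<and> t < s}
      = map_prod ((+) n) ((+) n) ` {(s,t). s \<in> A \<and> t \<in> C \<and> t < s}"
    by (force simp: image_iff)
  then show ?thesis unfolding invs_def
    by (simp add: card_image inj_on_def)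
qed

lemma invs_eq_0:
  assumes "\<And>a c. a \<in> A \<Longrightarrow> c \<in> C \<Longrightarrow> a < c"
  shows "invs A C = 0"
proof -
  have "{(s,t). s \<in> A \<and> t \<in> C \<and> t < s} = {}" using assms by fastforce
  then show ?thesis unfolding invs_def by (simp only: card.empty)
qed

lemma invs_eq_mult:
  assumes "\<And>a c. a \<in> A \<Longrightarrow> c \<in> C \<Longrightarrow> c < a"
  shows "invs A C = card A * card C"
proof -
  have "{(s,t). s \<in> A \<and> t \<in> C \<and> t < s} = A \<times> C" using assms by auto
  then show ?thesis by (simp add: invs_def card_cartesian_product)
qed

lemma wedge_invs: "wedge a b K = (\<Sum>S\<in>Pow K. (-1) ^ invs S (K - S) * a S * b (K - S))"
  by (simp add: wedge_def invs_def)

subsection \<open>Bigraded index sets\<close>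

text \<open>\<open>enc n A B\<close> is the index set of \<open>dz\<^sub>A \<and> dzbar\<^sub>B\<close>.\<close>
definition enc :: "nat \<Rightarrow> nat set \<Rightarrow> nat set \<Rightarrow> nat set" where
  "enc n A B = A \<union> (+) n ` B"

text \<open>Together with intersection with \<open>{..<n}\<close> this inverts
  \<open>enc n\<close>.\<close>

definition dec :: "nat \<Rightarrow> nat set \<Rightarrow> nat set" where
  "dec n K = {j. n + j \<in> K}"

lemma enc_Int_low: "A \<subseteq> {..<n} \<Longrightarrow> enc n A B \<inter> {..<n} = A"
  by (auto simp: enc_def)

lemma dec_enc: "A \<subseteq> {..<n} \<Longrightarrow> dec n (enc n A B) = B"
  by (auto simp: enc_def dec_def)

lemma enc_dec: "enc n (K \<inter> {..<n}) (dec n K) = K"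
proof (intro equalityI subsetI)
  fix x assume "x \<in> K"
  then show "x \<in> enc n (K \<inter> {..<n}) (dec n K)"
    by (cases "x < n") (auto simp: enc_def dec_def image_iff intro: exI[of _ "x - n"])
qed (auto simp: enc_def dec_def)

lemma dec_subset: "K \<subseteq> {..<2*n} \<Longrightarrow> dec n K \<subseteq> {..<n}"
  by (auto simp: dec_def)

lemma enc_subset: "A \<subseteq> {..<n} \<Longrightarrow> B \<subseteq> {..<n} \<Longrightarrow> enc n A B \<subseteq> {..<2*n}"
  by (auto simp: enc_def)

lemma enc_full: "enc n {..<n} {..<n} = {..<2*n}"
proof -
  have "dec n {..<2*n} = {..<n}" by (auto simp: dec_def)
  moreover have "{..<2*n} \<inter> {..<n} = {..<n}" by auto
  ultimately show ?thesis using enc_dec[of n "{..<2*n}"] by simp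
qed

lemma card_enc_high:
  assumes "A \<subseteq> {..<n}" "B \<subseteq> {..<n}"
  shows "card (enc n A B \<inter> {n..<2*n}) = card B"
proof -
  have "enc n A B \<inter> {n..<2*n} = (+) n ` B" using assms by (auto simp: enc_def)
  then show ?thesis by (simp add: card_image)
qed

lemma enc_Diff:
  assumes "A \<subseteq> {..<n}" "A' \<subseteq> {..<n}"
  shows "enc n A B - enc n A' B' = enc n (A - A') (B - B')"
  using assms by (auto simp: enc_def)

text \<open>Every \<open>dz\<close> index lies below every \<open>dzbar\<close> index. Hence
  \<open>A\<close> makes no inversion with the shifted \<open>D\<close>, while the shifted
  \<open>B\<close> makes one with each element of \<open>C\<close>: the sign of moving
  \<open>dzbar\<close> factors past \<open>dz\<close> factors.\<close>

lemma invs_enc: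
  assumes "A \<subseteq> {..<n}" "C \<subseteq> {..<n}" "finite B"
  shows "invs (enc n A B) (enc n C D) = invs A C + invs B D + card B * card C"
proof -
  have fin: "finite A" using assms finite_subset by blast
  have d: "A \<inter> (+) n ` B = {}" "C \<inter> (+) n ` D = {}" using assms by auto
  have "invs A ((+) n ` D) = 0" using assms by (intro invs_eq_0) auto
  moreover have "invs ((+) n ` B) C = card B * card C"
    using assms by (subst invs_eq_mult) (auto simp: card_image)
  ultimately show ?thesis
    unfolding enc_def using fin assms d
    by (simp add: invs_Un_left invs_Un_right invs_shift)
qed

lemma bij_betw_enc:
  assumes "A \<subseteq> {..<n}"
  shows "bij_betw (\<lambda>(S,T). enc n S T) (Pow A \<times> Pow B) (Pow (enc n A B))"
proof (rule bij_betw_byWitness[where f' = "\<lambda>K. (K \<inter> {..<n}, dec n K)"])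
  show "\<forall>x\<in>Pow A \<times> Pow B. (case case x of (S, T) \<Rightarrow> enc n S T of K \<Rightarrow> (K \<inter> {..<n}, dec n K)) = x"
    using assms by (auto simp: enc_def dec_def)
  show "(\<lambda>K. (K \<inter> {..<n}, dec n K)) ` Pow (enc n A B) \<subseteq> Pow A \<times> Pow B"
    using assms by (auto simp: enc_def dec_def)
qed (use enc_dec in \<open>auto simp: enc_def\<close>)

lemma wedge_enc:
  assumes A: "A \<subseteq> {..<n}" and B: "B \<subseteq> {..<n}"
  shows "wedge f g (enc n A B) = (\<Sum>S\<in>Pow A. \<Sum>T\<in>Pow B.
     (-1) ^ (invs S (A - S) + invs T (B - T) + card T * card (A - S))
       * f (enc n S T) * g (enc n (A - S) (B - T)))"
proof -
  have "wedge f g (enc n A B) = (\<Sum>(S,T)\<in>Pow A \<times> Pow B.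
      (-1) ^ invs (enc n S T) (enc n A B - enc n S T) * f (enc n S T) * g (enc n A B - enc n S T))"
    unfolding wedge_invs sum.reindex_bij_betw[OF bij_betw_enc[OF A], symmetric]
    by (simp add: case_prod_unfold)
  also have "\<dots> = (\<Sum>(S,T)\<in>Pow A \<times> Pow B.
     (-1) ^ (invs S (A - S) + invs T (B - T) + card T * card (A - S))
       * f (enc n S T) * g (enc n (A - S) (B - T)))"
  proof (intro sum.cong refl, clarify)
    fix S T assume "S \<subseteq> A" "T \<subseteq> B"
    then have S: "S \<subseteq> {..<n}" and T: "finite T"
      using A B finite_subset[of T "{..<n}"] by auto
    have "invs (enc n S T) (enc n (A - S) (B - T))
        = invs S (A - S) + invs T (B - T) + card T * card (A - S)"
      using S T A by (intro invs_enc) auto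
    then show "(-1) ^ invs (enc n S T) (enc n A B - enc n S T) * f (enc n S T)
          * g (enc n A B - enc n S T)
        = (-1) ^ (invs S (A - S) + invs T (B - T) + card T * card (A - S))
          * f (enc n S T) * g (enc n (A - S) (B - T))"
      using enc_Diff[OF A S] by simp
  qed
  finally show ?thesis by (simp add: sum.cartesian_product)
qed

text \<open>When both coefficient matrices have rank one, the double sum factors into two separate
  wedge products. Only \<open>f2\<close> and \<open>g1\<close> move past each other, so fixing their
  degrees makes the crossing sign constant.\<close>

lemma wedge_rank_one:
  fixes f1 f2 g1 g2 :: form
  assumes A: "A \<subseteq> {..<n}" and B: "B \<subseteq> {..<n}"
    and f: "\<And>S T. S \<subseteq> {..<n} \<Longrightarrow> T \<subseteq> {..<n} \<Longrightarrow> f (enc n S T) = x * f1 S * f2 T"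
    and g: "\<And>S T. S \<subseteq> {..<n} \<Longrightarrow> T \<subseteq> {..<n} \<Longrightarrow> g (enc n S T) = y * g1 S * g2 T"
    and q: "\<And>T. f2 T \<noteq> 0 \<Longrightarrow> card T = q" and r: "\<And>S. g1 S \<noteq> 0 \<Longrightarrow> card S = r"
  shows "wedge f g (enc n A B) = (-1) ^ (q * r) * x * y * wedge f1 g1 A * wedge f2 g2 B"
proof -
  have "wedge f g (enc n A B) = (\<Sum>S\<in>Pow A. \<Sum>T\<in>Pow B. (-1) ^ (q * r) * x * y *
     (((-1) ^ invs S (A - S) * f1 S * g1 (A - S)) * ((-1) ^ invs T (B - T) * f2 T * g2 (B - T))))"
    unfolding wedge_enc[OF A B]
  proof (intro sum.cong refl)
    fix S T assume "S \<in> Pow A" "T \<in> Pow B"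
    then have sub: "S \<subseteq> {..<n}" "T \<subseteq> {..<n}" "A - S \<subseteq> {..<n}" "B - T \<subseteq> {..<n}" using A B by auto
    show "(-1) ^ (invs S (A - S) + invs T (B - T) + card T * card (A - S))
       * f (enc n S T) * g (enc n (A - S) (B - T)) = (-1) ^ (q * r) * x * y *
     (((-1) ^ invs S (A - S) * f1 S * g1 (A - S)) * ((-1) ^ invs T (B - T) * f2 T * g2 (B - T)))"
    \<comment> \<open>Away from the prescribed degrees both sides vanish, so the sign matters only
      for \<open>card T = q\<close> and \<open>card (A - S) = r\<close>.\<close>
    proof (cases "f2 T = 0 \<or> g1 (A - S) = 0")
      case False
      then have "card T = q" "card (A - S) = r" using q r by auto
      then show ?thesis using f[of S T] g[of "A - S" "B - T"] sub
        by (simp add: power_add)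
    next
      case True
      then show ?thesis using f[of S T] g[of "A - S" "B - T"] sub by auto
    qed
  qed
  also have "\<dots> = (-1) ^ (q * r) * x * y * wedge f1 g1 A * wedge f2 g2 B"
    unfolding wedge_invs mult.assoc[of _ "sum _ _" "sum _ _"] sum_product by (simp add: sum_distrib_left)
  finally show ?thesis .
qed

lemma wedge_one_form_right: "finite K \<Longrightarrow> wedge f one_form K = f K"
proof -
  assume K: "finite K"
  have "invs K {} = 0" by (rule invs_eq_0) simp
  then have "wedge f one_form K = (\<Sum>S\<in>Pow K. if S = K then f K else 0)"
    unfolding wedge_invs
    by (intro sum.cong refl) (auto simp: one_form_def)
  then show ?thesis using K by (simp add: sum.delta)
qed

lemma wedge_one_form_left: "finite K \<Longrightarrow> wedge one_form f K = f K"
proof -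
  assume K: "finite K"
  have "invs {} K = 0" by (rule invs_eq_0) simp
  then have "wedge one_form f K = (\<Sum>S\<in>Pow K. if S = {} then f K else 0)"
    unfolding wedge_invs
    by (intro sum.cong refl) (auto simp: one_form_def)
  then show ?thesis using K by (simp add: sum.delta)
qed

lemma wedge_support:
  assumes "\<And>K. f K \<noteq> 0 \<Longrightarrow> K \<subseteq> U" "\<And>K. g K \<noteq> 0 \<Longrightarrow> K \<subseteq> U" "wedge f g K \<noteq> 0"
  shows "K \<subseteq> U"
proof -
  obtain S where "S \<in> Pow K" "(-1) ^ invs S (K - S) * f S * g (K - S) \<noteq> 0"
    using assms(3) unfolding wedge_invs by (rule sum.not_neutral_contains_not_neutral)
  then show ?thesis using assms(1)[of S] assms(2)[of "K - S"] by auto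
qed

subsection \<open>Minors\<close>

abbreviation pos_sign :: "nat set \<Rightarrow> nat \<Rightarrow> complex" where
  "pos_sign A a \<equiv> (-1) ^ card {b \<in> A. b < a}"

text \<open>Laplace expansion along the first row of the determinant with the listed rows and the
  columns \<open>A\<close> in increasing order; \<open>pos_sign\<close> is the cofactor sign. These
  are the Pluecker coordinates of the rows, and the recursion itself yields 0 when the numbers of
  rows and columns differ.\<close>

fun minor :: "(nat \<Rightarrow> complex) list \<Rightarrow> nat set \<Rightarrow> complex" where
  "minor [] A = (if A = {} then 1 else 0)"
| "minor (c # cs) A = (\<Sum>a\<in>A. pos_sign A a * c a * minor cs (A - {a}))"

lemma minor_card:
  assumes "minor cs A \<noteq> 0"
  shows "finite A \<and> card A = length cs"
  using assms
proof (induction cs arbitrary: A)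
  case (Cons c cs)
  then obtain a where a: "a \<in> A" "minor cs (A - {a}) \<noteq> 0"
    by (metis (no_types, lifting) minor.simps(2) mult_zero_right sum.neutral)
  then have "finite (A - {a})" "card (A - {a}) = length cs" using Cons.IH[OF a(2)] by blast+
  then have "finite A" "card A = Suc (length cs)"
    using card_Suc_Diff1[OF _ a(1)] finite_Diff2[of "{a}" A] by simp_all
  then show ?case by simp
qed (auto split: if_splits)

section \<open>One-forms and products of \<open>i_gamma_gammabar\<close> expressed by minors\<close>

lemma oneform10_eq: "oneform10 n c K = (\<Sum>j<n. if K = {j} then c j else 0)"
  by (simp add: oneform10_def dz_def if_distrib cong: if_cong)

text \<open>Only singletons \<open>{a}\<close> contribute, and the inversions of \<open>{a}\<close>
  with the rest of \<open>A\<close> count the elements below \<open>a\<close>: wedging with a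
  one-form is a Laplace expansion.\<close>

lemma wedge_oneform10:
  assumes A: "A \<subseteq> {..<n}"
  shows "wedge (oneform10 n c) g A = (\<Sum>a\<in>A. pos_sign A a * c a * g (A - {a}))"
proof -
  have fin: "finite A" using A finite_subset by blast
  have "wedge (oneform10 n c) g A = (\<Sum>S\<in>Pow A. \<Sum>j<n. if S = {j} then
      (-1) ^ invs {j} (A - {j}) * c j * g (A - {j}) else 0)"
    unfolding wedge_invs oneform10_eq sum_distrib_left sum_distrib_right
    by (intro sum.cong refl) auto
  also have "\<dots> = (\<Sum>j<n. \<Sum>S\<in>Pow A. if S = {j} then
      (-1) ^ invs {j} (A - {j}) * c j * g (A - {j}) else 0)"
    by (rule sum.swap)
  also have "\<dots> = (\<Sum>j<n. if j \<in> A then (-1) ^ invs {j} (A - {j}) * c j * g (A - {j}) else 0)"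
    using fin by (intro sum.cong refl) (simp add: sum.delta)
  also have "\<dots> = (\<Sum>j\<in>A. (-1) ^ invs {j} (A - {j}) * c j * g (A - {j}))"
    using A by (simp add: sum.inter_restrict[symmetric] Int_absorb1)
  also have "\<dots> = (\<Sum>a\<in>A. pos_sign A a * c a * g (A - {a}))"
  proof (intro sum.cong refl)
    fix j
    have "{(s,t). s \<in> {j} \<and> t \<in> A - {j} \<and> t < s} = Pair j ` {b \<in> A. b < j}" by auto
    then have "invs {j} (A - {j}) = card {b \<in> A. b < j}"
      unfolding invs_def by (simp add: card_image inj_on_def)
    then show "(-1) ^ invs {j} (A - {j}) * c j * g (A - {j}) = pos_sign A j * c j * g (A - {j})"
      by simp
  qed
  finally show ?thesis .
qed

lemma oneform10_minor:
  assumes "A \<subseteq> {..<n}"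
  shows "oneform10 n c A = minor [c] A"
  using wedge_oneform10[OF assms, of c one_form] wedge_one_form_right[of A] assms finite_subset[of A "{..<n}"]
  by (simp add: one_form_def)

lemma enc_eq_singleton_low:
  "j < n \<Longrightarrow> S \<subseteq> {..<n} \<Longrightarrow> enc n S T = {j} \<longleftrightarrow> S = {j} \<and> T = {}"
  by (auto simp: enc_def)

lemma enc_eq_singleton_high:
  "S \<subseteq> {..<n} \<Longrightarrow> enc n S T = {n + j} \<longleftrightarrow> S = {} \<and> T = {j}"
  by (force simp: enc_def)

text \<open>The factor \<open>one_form T\<close> records that no \<open>dzbar\<close> occurs; this
  is the rank-one shape that \<open>wedge_rank_one\<close> takes.\<close>

lemma oneform10_enc:
  assumes "S \<subseteq> {..<n}"
  shows "oneform10 n c (enc n S T) = oneform10 n c S * one_form T"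
  unfolding oneform10_eq sum_distrib_right
  using assms by (intro sum.cong refl) (auto simp: enc_eq_singleton_low one_form_def)

lemma conj_oneform10_enc:
  assumes "S \<subseteq> {..<n}"
  shows "conj_oneform10 n c (enc n S T) = one_form S * cnj (oneform10 n c T)"
  unfolding oneform10_eq conj_oneform10_def dzbar_def sum_distrib_left cnj_sum
  using assms by (intro sum.cong refl) (auto simp: enc_eq_singleton_high one_form_def)

lemma i_gamma_gammabar_enc:
  assumes A: "A \<subseteq> {..<n}" and B: "B \<subseteq> {..<n}"
  shows "i_gamma_gammabar n c (enc n A B) = \<i> * minor [c] A * cnj (minor [c] B)"
proof -
  have fin: "finite A" "finite B" using A B finite_subset by blast+
  have "wedge (oneform10 n c) (conj_oneform10 n c) (enc n A B)
      = (-1) ^ (0 * 0) * 1 * 1 * wedge (oneform10 n c) one_form A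
        * wedge one_form (\<lambda>T. cnj (oneform10 n c T)) B"
    by (rule wedge_rank_one[OF A B])
      (auto simp: oneform10_enc conj_oneform10_enc one_form_def split: if_splits)
  then show ?thesis
    unfolding i_gamma_gammabar_def scale_form_def
    using fin by (simp only: wedge_one_form_left wedge_one_form_right oneform10_minor[OF A] oneform10_minor[OF B]) simp
qed

lemma i_gamma_gammabar_support:
  assumes "i_gamma_gammabar n c K \<noteq> 0"
  shows "K \<subseteq> {..<2*n}"
proof -
  have "wedge (oneform10 n c) (conj_oneform10 n c) K \<noteq> 0"
    using assms unfolding i_gamma_gammabar_def scale_form_def by (metis mult_zero_right)
  moreover have "K \<subseteq> {..<2*n}" if nz: "oneform10 n c K \<noteq> 0" for K
  proof -
    obtain j where "j \<in> {..<n}" "(if K = {j} then c j else 0) \<noteq> 0"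
      using nz unfolding oneform10_eq by (rule sum.not_neutral_contains_not_neutral)
    then show ?thesis by (auto split: if_splits)
  qed
  moreover have "K \<subseteq> {..<2*n}" if nz: "conj_oneform10 n c K \<noteq> 0" for K
  proof -
    obtain j where "j \<in> {..<n}" "cnj (c j) * (if K = {n + j} then 1 else 0) \<noteq> 0"
      using nz unfolding conj_oneform10_def dzbar_def
      by (rule sum.not_neutral_contains_not_neutral)
    then show ?thesis by (auto split: if_splits)
  qed
  ultimately show ?thesis
    using wedge_support[of "oneform10 n c" "{..<2*n}" "conj_oneform10 n c" K] by blast
qed

text \<open>Sign of reordering \<open>i\<gamma>\<^sub>1 \<and> \<gamma>bar\<^sub>1 \<and> \<dots> \<and> i\<gamma>\<^sub>k \<and> \<gamma>bar\<^sub>k\<close> into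
  \<open>\<gamma>\<^sub>1 \<and> \<dots> \<and> \<gamma>\<^sub>k \<and> \<gamma>bar\<^sub>1 \<and> \<dots> \<and> \<gamma>bar\<^sub>k\<close>, times \<open>i\<^sup>k\<close>.\<close>
fun sig :: "nat \<Rightarrow> complex" where
  "sig 0 = 1"
| "sig (Suc k) = \<i> * (-1) ^ k * sig k"

text \<open>This cancels the crossing sign of two (k,k)-forms, because \<open>k * k\<close> and
  \<open>k\<close> have the same parity.\<close>

lemma sig_square: "sig k * sig k = (-1) ^ k"
proof (induction k)
  case (Suc k)
  have "sig (Suc k) * sig (Suc k) = (\<i> * \<i>) * ((-1) ^ k * (-1) ^ k) * (sig k * sig k)"
    by (simp add: mult_ac)
  then show ?case using Suc by (simp add: power_add[symmetric])
qed simp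

text \<open>Consecutive factors i and -i multiply to 1. In even dimension the volume form therefore
  has coefficient 1 at the full index set.\<close>

lemma sig_even: "sig (2 * k) = 1"
  by (induction k) simp_all

lemma wedge_minor_Cons:
  assumes "A \<subseteq> {..<n}"
  shows "wedge (minor [c]) (minor cs) A = minor (c # cs) A"
proof -
  have "wedge (minor [c]) (minor cs) A = wedge (oneform10 n c) (minor cs) A"
    unfolding wedge_invs using assms by (intro sum.cong refl) (simp add: oneform10_minor del: minor.simps)
  then show ?thesis using wedge_oneform10[OF assms] by simp
qed

lemma wedge_cnj: "wedge (\<lambda>K. cnj (f K)) (\<lambda>K. cnj (g K)) K = cnj (wedge f g K)"
  by (simp add: wedge_invs)

text \<open>Induction with \<open>wedge_rank_one\<close>: moving the first conjugate factor past the
  remaining holomorphic ones gives the sign in the recursion of \<open>sig\<close>. Up to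
  \<open>sig\<close>, the coefficient matrix is the rank-one Hermitian matrix of the vector of
  minors.\<close>

lemma wedge_list_i_gamma_gammabar_enc:
  assumes "A \<subseteq> {..<n}" "B \<subseteq> {..<n}"
  shows "wedge_list (map (i_gamma_gammabar n) gs) (enc n A B)
    = sig (length gs) * minor gs A * cnj (minor gs B)"
  using assms
proof (induction gs arbitrary: A B)
  case Nil
  then show ?case by (auto simp: one_form_def enc_def)
next
  case (Cons c cs)
  have "wedge_list (map (i_gamma_gammabar n) (c # cs)) (enc n A B)
     = (-1) ^ (1 * length cs) * \<i> * sig (length cs) * wedge (minor [c]) (minor cs) A
        * wedge (\<lambda>T. cnj (minor [c] T)) (\<lambda>T. cnj (minor cs T)) B"
    unfolding list.map wedge_list.simps
    by (rule wedge_rank_one[OF Cons.prems])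
      (auto simp: i_gamma_gammabar_enc Cons.IH dest: minor_card simp del: minor.simps)
  then show ?case
    using Cons.prems by (simp add: wedge_cnj wedge_minor_Cons del: minor.simps)
qed

lemma wedge_list_i_gamma_gammabar_support:
  "wedge_list (map (i_gamma_gammabar n) gs) K \<noteq> 0 \<Longrightarrow> K \<subseteq> {..<2*n}"
proof (induction gs arbitrary: K)
  case Nil
  then show ?case by (auto simp: one_form_def split: if_splits)
next
  case (Cons c cs)
  show ?case using wedge_support[OF i_gamma_gammabar_support Cons.IH] Cons.prems by auto
qed

lemma is_pq_form_encI:
  assumes "\<And>K. f K \<noteq> 0 \<Longrightarrow> K \<subseteq> {..<2*n}"
    and "\<And>A B. A \<subseteq> {..<n} \<Longrightarrow> B \<subseteq> {..<n} \<Longrightarrow> f (enc n A B) \<noteq> 0 \<Longrightarrow> card A = p \<and> card B = q"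
  shows "is_pq_form n p q f"
  unfolding is_pq_form_def
proof (intro allI impI)
  fix K assume K: "f K \<noteq> 0"
  define A B where "A = K \<inter> {..<n}" and "B = dec n K"
  have sub: "K \<subseteq> {..<2*n}" using assms(1) K .
  have AB: "A \<subseteq> {..<n}" "B \<subseteq> {..<n}" "K = enc n A B"
    using dec_subset[OF sub] enc_dec[of n K] by (auto simp: A_def B_def)
  have "card A = p \<and> card B = q" using assms(2)[OF AB(1,2)] K AB(3) by simp
  then show "K \<subseteq> {..<2*n} \<and> card (K \<inter> {..<n}) = p \<and> card (K \<inter> {n..<2*n}) = q"
    using sub card_enc_high[OF AB(1,2)] enc_Int_low[OF AB(1), of B] unfolding AB(3)[symmetric] by simp
qed

lemma is_pq_form_wedge_list:
  "is_pq_form n (length gs) (length gs) (wedge_list (map (i_gamma_gammabar n) gs))"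
  by (rule is_pq_form_encI)
    (auto simp: wedge_list_i_gamma_gammabar_enc dest: minor_card wedge_list_i_gamma_gammabar_support)

section \<open>The volume form and forms of top degree\<close>

lemma minor_units:
  assumes "k \<le> n"
  shows "minor (map (\<lambda>j i. if i = j then 1 else 0) [k..<n]) {k..<n} = 1"
  using assms
proof (induction k rule: inc_induct)
  case (step k)
  have 1: "[k..<n] = k # [Suc k..<n]" "{k..<n} - {k} = {Suc k..<n}" using step by (auto simp: upt_conv_Cons)
  \<comment> \<open>In the first row only column \<open>k\<close> is nonzero, and no element of
    \<open>{k..<n}\<close> precedes it, so its sign is 1.\<close>
  have "minor (map (\<lambda>j i. if i = j then 1 else 0) [k..<n]) {k..<n} =
    (\<Sum>a\<in>{k..<n}. if a = k then pos_sign {k..<n} k *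
       minor (map (\<lambda>j i. if i = j then 1 else 0) [Suc k..<n]) ({k..<n} - {k}) else 0)"
    unfolding 1(1) list.map minor.simps by (intro sum.cong refl) auto
  also have "\<dots> = pos_sign {k..<n} k" using step 1(2) by (simp add: sum.delta)
  also have "{b \<in> {k..<n}. b < k} = {}" by auto
  finally show ?case by simp
qed simp

text \<open>The volume form is the product for the standard unit covectors, so the minor formulas
  apply to it.\<close>

lemma dV_wedge_list:
  "dV n = wedge_list (map (i_gamma_gammabar n) (map (\<lambda>j i. if i = j then 1 else 0) [0..<n]))"
proof -
  have "scale_form \<i> (wedge (dz j) (dzbar n j)) = i_gamma_gammabar n (\<lambda>i. if i = j then 1 else 0)"
    if "j < n" for j
  proof -
    have *: "(\<Sum>i<n. (if i = j then 1 else 0) * h i) = h j" for h :: "nat \<Rightarrow> complex"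
    proof -
      have "(\<Sum>i<n. (if i = j then 1 else 0) * h i) = (\<Sum>i<n. if i = j then h i else 0)"
        by (intro sum.cong refl) auto
      then show ?thesis using that by (simp add: sum.delta)
    qed
    have "oneform10 n (\<lambda>i. if i = j then 1 else 0) = dz j"
      unfolding oneform10_def by (simp add: *)
    moreover have "conj_oneform10 n (\<lambda>i. if i = j then 1 else 0) = dzbar n j"
      unfolding conj_oneform10_def if_distrib[of cnj] complex_cnj_one complex_cnj_zero by (simp add: *)
    ultimately show ?thesis by (simp add: i_gamma_gammabar_def)
  qed
  then show ?thesis unfolding dV_def map_map comp_def by (intro arg_cong[where f = wedge_list] map_cong) auto
qed

lemma dV_full: "dV n {..<2*n} = sig n"
  unfolding dV_wedge_list enc_full[symmetric]
  using minor_units[of 0 n]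
  by (simp add: wedge_list_i_gamma_gammabar_enc lessThan_atLeast0 del: minor.simps map_map)

lemma full_index_set:
  assumes "K \<subseteq> {..<2*n}" "card (K \<inter> {..<n}) = n" "card (K \<inter> {n..<2*n}) = n"
  shows "K = {..<2*n}"
proof -
  have "K \<inter> {..<n} = {..<n}" by (rule card_subset_eq) (use assms in auto)
  moreover have "K \<inter> {n..<2*n} = {n..<2*n}" by (rule card_subset_eq) (use assms in auto)
  ultimately have "{..<n} \<union> {n..<2*n} \<subseteq> K" by blast
  moreover have "{..<n} \<union> {n..<2*n} = {..<2*n}" by auto
  ultimately show ?thesis using assms(1) by auto
qed

lemma dV_other:
  assumes "K \<noteq> {..<2*n}"
  shows "dV n K = 0"
proof (rule ccontr)
  assume nz: "dV n K \<noteq> 0"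
  have "is_pq_form n n n (dV n)"
    unfolding dV_wedge_list using is_pq_form_wedge_list[of n "map (\<lambda>j i. if i = j then 1 else 0) [0..<n]"] by simp
  then have K: "K \<subseteq> {..<2*n}" "card (K \<inter> {..<n}) = n" "card (K \<inter> {n..<2*n}) = n"
    using nz by (auto simp: is_pq_form_def)
  then show False using full_index_set assms by blast
qed

text \<open>Bidegrees add up to \<open>2*p\<close> in both kinds of index, which forces the full
  index set. There \<open>dV\<close> has coefficient 1 by \<open>sig_even\<close>, so the scalar is
  the coefficient of the product itself.\<close>

lemma wedge_top_degree:
  assumes f: "is_pq_form (2*p) p p f" and g: "is_pq_form (2*p) p p g"
  shows "wedge f g = scale_form (wedge f g {..<2*(2*p)}) (dV (2*p))"
proof
  fix K
  let ?n = "2*p"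
  show "wedge f g K = scale_form (wedge f g {..<2*?n}) (dV ?n) K"
  proof (cases "K = {..<2*?n}")
    case True
    then show ?thesis using dV_full[of ?n] by (simp add: scale_form_def sig_even)
  next
    case False
    have "wedge f g K = 0"
    proof (rule ccontr)
      assume nz: "wedge f g K \<noteq> 0"
      then obtain S where S: "S \<in> Pow K" "(-1) ^ invs S (K - S) * f S * g (K - S) \<noteq> 0"
        unfolding wedge_invs by (rule sum.not_neutral_contains_not_neutral)
      then have nz: "f S \<noteq> 0" "g (K - S) \<noteq> 0" by auto
      have K: "K \<subseteq> {..<2*?n}" using nz f g S(1) unfolding is_pq_form_def by blast
      then have fin: "finite K" using finite_subset by blast
      have "card (K \<inter> L) = card (S \<inter> L) + card ((K - S) \<inter> L)" for L
        using S(1) fin by (subst card_Un_disjoint[symmetric]) (auto intro: finite_subset arg_cong[where f = card])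
      then have c: "card (K \<inter> {..<?n}) = ?n" "card (K \<inter> {?n..<2*?n}) = ?n"
        using nz f g unfolding is_pq_form_def by auto
      then show False using full_index_set[OF K c] False by blast
    qed
    then show ?thesis using dV_other[OF False] by (simp add: scale_form_def)
  qed
qed

subsection \<open>The Pluecker relation\<close>

lemma pos_sign_remove:
  assumes "finite A" "a \<in> A"
  shows "pos_sign (A - {a}) b = (if a < b then -1 else 1) * pos_sign A b"
proof (cases "a < b")
  case True
  then have "{x \<in> A. x < b} = insert a {x \<in> A - {a}. x < b}" using assms by auto
  then show ?thesis using True assms by simp
next
  case False
  then have "{x \<in> A - {a}. x < b} = {x \<in> A. x < b}" by auto
  then show ?thesis using False by simp
qed

text \<open>The diagonal is kept with value 0 so that both sums range over the same set and can be
  interchanged.\<close>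

lemma minor_Cons_Cons:
  assumes "finite A"
  shows "minor (c # d # cs) A = (\<Sum>a\<in>A. \<Sum>b\<in>A. if a = b then 0 else
    pos_sign A a * pos_sign (A - {a}) b * c a * d b * minor cs (A - {a,b}))"
proof -
  have "pos_sign A a * c a * minor (d # cs) (A - {a}) = (\<Sum>b\<in>A. if a = b then 0 else
    pos_sign A a * pos_sign (A - {a}) b * c a * d b * minor cs (A - {a,b}))" for a
  proof -
    have "pos_sign A a * c a * minor (d # cs) (A - {a}) = (\<Sum>b\<in>A - {a}. if a = b then 0 else
      pos_sign A a * pos_sign (A - {a}) b * c a * d b * minor cs (A - {a,b}))"
      unfolding minor.simps sum_distrib_left
      by (intro sum.cong refl) (auto simp: Diff_insert2[symmetric] insert_commute)
    also have "\<dots> = (\<Sum>b\<in>A. if a = b then 0 else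
      pos_sign A a * pos_sign (A - {a}) b * c a * d b * minor cs (A - {a,b}))"
      using assms by (intro sum.mono_neutral_left) auto
    finally show ?thesis .
  qed
  then show ?thesis by simp
qed

text \<open>Match the pair (a,b) with (b,a). Removing the smaller column first shifts the larger one
  by one place, removing the larger first shifts nothing, so the signs are opposite.\<close>

lemma minor_swap: "minor (c # d # cs) A = - minor (d # c # cs) A"
proof (cases "finite A")
  case True
  have "minor (c # d # cs) A = (\<Sum>b\<in>A. \<Sum>a\<in>A. if a = b then 0 else
    pos_sign A a * pos_sign (A - {a}) b * c a * d b * minor cs (A - {a,b}))"
    unfolding minor_Cons_Cons[OF True] by (rule sum.swap)
  also have "\<dots> = (\<Sum>b\<in>A. \<Sum>a\<in>A. - (if b = a then 0 else
    pos_sign A b * pos_sign (A - {b}) a * d b * c a * minor cs (A - {b,a})))"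
  proof (intro sum.cong refl)
    fix a b assume ab: "b \<in> A" "a \<in> A"
    show "(if a = b then 0 else
      pos_sign A a * pos_sign (A - {a}) b * c a * d b * minor cs (A - {a,b}))
      = - (if b = a then 0 else
      pos_sign A b * pos_sign (A - {b}) a * d b * c a * minor cs (A - {b,a}))"
      unfolding pos_sign_remove[OF True ab(1)] pos_sign_remove[OF True ab(2)] insert_commute[of a b]
      by (cases a b rule: linorder_cases) (simp_all only: if_True if_False, simp_all)
  qed
  also have "\<dots> = - minor (d # c # cs) A"
    unfolding minor_Cons_Cons[OF True] by (simp add: sum_negf)
  finally show ?thesis .
qed simp

text \<open>If the equal rows are adjacent, the minor is its own negative; otherwise
  \<open>c\<close> is swapped past the next row.\<close>

lemma minor_repeated: "c \<in> set cs \<Longrightarrow> minor (c # cs) A = 0"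
proof (induction cs arbitrary: A)
  case (Cons d cs)
  show ?case
  proof (cases "c = d")
    case True
    have "minor (c # c # cs) A = - minor (c # c # cs) A" by (rule minor_swap)
    then show ?thesis using True by (simp only: eq_neg_iff_add_eq_0) simp
  next
    case False
    then have "minor (c # cs) B = 0" for B using Cons by simp
    then have "minor (d # c # cs) A = 0" 
      unfolding minor.simps(2)[of d] by (simp only: mult_zero_right sum.neutral_const)
    then show ?thesis unfolding minor_swap[of c d] by simp
  qed
qed simp

text \<open>As a function of the column \<open>j\<close> this is a linear combination of the rows; a functional
  vanishing on all rows therefore vanishes on it, which is the Pluecker relation.\<close>
fun column_expansion :: "(nat \<Rightarrow> complex) list \<Rightarrow> nat set \<Rightarrow> nat \<Rightarrow> complex" where
  "column_expansion [] R j = 0"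
| "column_expansion (c # cs) R j =
    c j * minor cs R - (\<Sum>a\<in>R. pos_sign R a * c a * column_expansion cs (R - {a}) j)"

text \<open>\<open>column_expansion cs R j\<close> is the determinant with column \<open>j\<close>
  placed in front of the columns \<open>R\<close>. Sorting \<open>j\<close> into place costs
  \<open>pos_sign R j\<close>; for \<open>j\<close> in \<open>R\<close> a column is repeated and the
  determinant is 0.\<close>

lemma column_expansion_minor:
  assumes "finite R"
  shows "(j \<notin> R \<longrightarrow> minor cs (insert j R) = pos_sign R j * column_expansion cs R j)
    \<and> (j \<in> R \<longrightarrow> column_expansion cs R j = 0)"
  using assms
proof (induction cs arbitrary: R)
  case (Cons c cs)
  have out: "minor cs (insert j S) = pos_sign S j * column_expansion cs S j" if "finite S" "j \<notin> S" for S
    using Cons.IH that by blast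
  have ins: "column_expansion cs S j = 0" if "finite S" "j \<in> S" for S
    using Cons.IH that by blast
  have fin: "finite R" by fact
  have 1: "minor (c # cs) (insert j R) = pos_sign R j * column_expansion (c # cs) R j" if j: "j \<notin> R"
  proof -
    have "pos_sign (insert j R) a * c a * minor cs (insert j R - {a})
        = - pos_sign R j * (pos_sign R a * c a * column_expansion cs (R - {a}) j)" if a: "a \<in> R" for a
    proof -
      have "insert j R - {a} = insert j (R - {a})" using a j by auto
      moreover have "minor cs (insert j (R - {a})) = pos_sign (R - {a}) j * column_expansion cs (R - {a}) j"
        using fin j by (intro out) auto
      \<comment> \<open>Inserting \<open>j\<close> shifts \<open>a\<close> if \<open>j < a\<close>,
        and removing \<open>a\<close> shifts \<open>j\<close> if \<open>a < j\<close>. Exactly one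
        of these happens, which yields the minus sign of the recursion.\<close>
      moreover have "pos_sign R a = (if j < a then -1 else 1) * pos_sign (insert j R) a"
        using pos_sign_remove[of "insert j R" j a] fin j by simp
      moreover have "pos_sign (R - {a}) j = (if a < j then -1 else 1) * pos_sign R j"
        using fin a by (rule pos_sign_remove)
      moreover have "a \<noteq> j" using a j by auto
      ultimately show ?thesis by (cases "a < j") auto
    qed
    then have "(\<Sum>a\<in>R. pos_sign (insert j R) a * c a * minor cs (insert j R - {a}))
        = - pos_sign R j * (\<Sum>a\<in>R. pos_sign R a * c a * column_expansion cs (R - {a}) j)"
      by (simp add: sum_distrib_left)
    moreover have "{b \<in> insert j R. b < j} = {b \<in> R. b < j}" by auto
    ultimately show ?thesis using fin j
      by (simp add: sum.insert algebra_simps)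
  qed
  have 2: "column_expansion (c # cs) R j = 0" if j: "j \<in> R"
  proof -
    \<comment> \<open>By induction only the term \<open>a = j\<close> survives, and it cancels the
      leading term \<open>c j * minor cs R\<close>.\<close>
    have "(\<Sum>a\<in>R. pos_sign R a * c a * column_expansion cs (R - {a}) j)
        = (\<Sum>a\<in>R. if a = j then pos_sign R j * c j * column_expansion cs (R - {j}) j else 0)"
      using fin j by (intro sum.cong refl) (auto simp: ins)
    also have "\<dots> = pos_sign R j * c j * column_expansion cs (R - {j}) j"
      using fin j by (simp add: sum.delta)
    also have "\<dots> = c j * minor cs R"
    proof -
      have "minor cs (insert j (R - {j})) = pos_sign (R - {j}) j * column_expansion cs (R - {j}) j"
        using fin by (intro out) auto
      then show ?thesis using pos_sign_remove[OF fin j, of j] j by (simp add: insert_absorb)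
    qed
    finally show ?thesis by simp
  qed
  show ?case using 1 2 by blast
qed simp

lemma column_expansion_span:
  assumes "\<And>c. c \<in> set cs \<Longrightarrow> (\<Sum>j\<in>A. w j * c j) = 0"
  shows "(\<Sum>j\<in>A. w j * column_expansion cs R j) = 0"
  using assms
proof (induction cs arbitrary: R)
  case (Cons c cs)
  have IH: "(\<Sum>j\<in>A. w j * column_expansion cs S j) = 0" for S
    using Cons by simp
  have "(\<Sum>j\<in>A. w j * column_expansion (c # cs) R j)
     = minor cs R * (\<Sum>j\<in>A. w j * c j)
       - (\<Sum>j\<in>A. \<Sum>a\<in>R. pos_sign R a * c a * (w j * column_expansion cs (R - {a}) j))"
    by (simp add: sum_subtractf sum_distrib_left algebra_simps)
  also have "(\<Sum>j\<in>A. \<Sum>a\<in>R. pos_sign R a * c a * (w j * column_expansion cs (R - {a}) j))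
     = (\<Sum>a\<in>R. pos_sign R a * c a * (\<Sum>j\<in>A. w j * column_expansion cs (R - {a}) j))"
    unfolding sum_distrib_left by (rule sum.swap)
  also have "\<dots> = 0" by (simp add: IH)
  finally show ?case using Cons.prems[of c] by simp
qed simp

text \<open>The functional with weights \<open>pos_sign A j * minor gs (A - {j})\<close> sends a row
  \<open>c\<close> to \<open>minor (c # gs) A\<close>, which has a repeated row.\<close>

lemma plucker_relation:
  "(\<Sum>j\<in>A. pos_sign A j * minor gs (A - {j}) * column_expansion gs R j) = 0"
proof (rule column_expansion_span)
  fix c assume "c \<in> set gs"
  then have "minor (c # gs) A = 0" by (rule minor_repeated)
  then show "(\<Sum>j\<in>A. pos_sign A j * minor gs (A - {j}) * c j) = 0"
    by (simp add: mult.commute mult.left_commute)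
qed

text \<open>Isolate the term at \<open>i\<close> in the Pluecker relation and apply the triangle
  inequality; terms with \<open>j\<close> in \<open>R\<close> vanish.\<close>

lemma plucker_bound:
  assumes A: "finite A" and R: "finite R" and i: "i \<in> A" "i \<notin> R"
  shows "norm (minor gs (A - {i})) * norm (minor gs (insert i R))
    \<le> (\<Sum>j\<in>A - R - {i}. norm (minor gs (A - {j})) * norm (minor gs (insert j R)))"
proof -
  let ?t = "\<lambda>j. pos_sign A j * minor gs (A - {j}) * column_expansion gs R j"
  have n: "norm (?t j) = norm (minor gs (A - {j})) * norm (minor gs (insert j R))" if "j \<notin> R" for j
    using column_expansion_minor[OF R, of j gs] that by (simp add: norm_mult norm_power)
  have "?t i + sum ?t (A - {i}) = 0"
    using plucker_relation[of A gs R] sum.remove[OF A i(1), of ?t] by simp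
  then have "sum ?t (A - {i}) = - ?t i" by (simp only: add_eq_0_iff)
  then have "norm (?t i) = norm (sum ?t (A - {i}))" by (simp only: norm_minus_cancel)
  also have "sum ?t (A - {i}) = sum ?t (A - R - {i})"
    using A column_expansion_minor[OF R] by (intro sum.mono_neutral_right) auto
  also have "norm (sum ?t (A - R - {i})) \<le> (\<Sum>j\<in>A - R - {i}. norm (?t j))" by (rule norm_sum)
  also have "\<dots> = (\<Sum>j\<in>A - R - {i}. norm (minor gs (A - {j})) * norm (minor gs (insert j R)))"
    by (intro sum.cong refl n) auto
  finally show ?thesis using n[OF i(2)] by simp
qed

subsection \<open>The Hermitian form for \<open>p = 3\<close>\<close>

abbreviation X3 :: "nat set" where "X3 \<equiv> {0,1,2}"
abbreviation Y3 :: "nat set" where "Y3 \<equiv> {3,4,5}"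

definition weight :: "nat set \<Rightarrow> real" where
  "weight D = (if D \<subseteq> {..<6} \<and> card D = 3 then if D = X3 \<or> D = Y3 then 3 else 1 else 0)"

text \<open>The entry 6 occurs twice, so positivity has to absorb 12 times a product of two
  coordinates: half by the weights 3 at \<open>X3\<close> and \<open>Y3\<close>, half by the other
  triples.\<close>

definition herm :: "nat set \<Rightarrow> nat set \<Rightarrow> real" where
  "herm D E = (if D = E then weight D else 0)
    + (if D = X3 \<and> E = Y3 \<or> D = Y3 \<and> E = X3 then 6 else 0)"

lemma X3_neq_Y3: "X3 \<noteq> Y3"
proof -
  have "0 \<in> X3" "0 \<notin> Y3" by auto
  then show ?thesis by metis
qed

lemma compl_X3: "{..<6} - X3 = Y3" and compl_Y3: "{..<6} - Y3 = X3"
  by (auto simp: lessThan_Suc numeral_eq_Suc)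

lemma X3_subset: "X3 \<subseteq> {..<6}" and Y3_subset: "Y3 \<subseteq> {..<6}"
  by auto

lemma weight_nonneg: "weight D \<ge> 0"
  by (simp add: weight_def)

lemma weight_XY: "weight X3 = 3" "weight Y3 = 3"
  by (simp_all add: weight_def)

lemma weight_compl:
  assumes "D \<subseteq> {..<6}"
  shows "weight ({..<6} - D) = weight D"
proof -
  have "card ({..<6} - D) = 3 \<longleftrightarrow> card D = 3"
    using assms card_mono[OF _ assms] by (subst card_Diff_subset) (auto intro: finite_subset)
  moreover have "{..<6} - D = X3 \<longleftrightarrow> D = Y3" "{..<6} - D = Y3 \<longleftrightarrow> D = X3"
    using compl_X3 compl_Y3 assms by (metis double_diff subset_refl)+
  ultimately show ?thesis using assms by (auto simp: weight_def)
qed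

lemma sum_weight_square: "(\<Sum>D\<in>Pow {..<6}. weight D * weight D) = 36"
proof -
  let ?S = "{D. D \<subseteq> {..<6::nat} \<and> card D = 3}"
  have fin: "finite ?S" by simp
  have XY: "{X3, Y3} \<subseteq> ?S" by auto
  have c: "card ?S = 20" using n_subsets[of "{..<6::nat}" 3] by (simp add: numeral_eq_Suc)
  have "(\<Sum>D\<in>Pow {..<6}. weight D * weight D) = (\<Sum>D\<in>?S. weight D * weight D)"
    by (intro sum.mono_neutral_right) (auto simp: weight_def)
  also have "\<dots> = (\<Sum>D\<in>?S - {X3, Y3}. weight D * weight D) + (\<Sum>D\<in>{X3, Y3}. weight D * weight D)"
    by (rule sum.subset_diff[OF XY fin])
  also have "(\<Sum>D\<in>?S - {X3, Y3}. weight D * weight D) = (\<Sum>D\<in>?S - {X3, Y3}. 1)"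
    by (intro sum.cong refl) (auto simp: weight_def)
  also have "\<dots> = 18" using c XY X3_neq_Y3 fin by (simp add: card_Diff_subset)
  also have "(\<Sum>D\<in>{X3, Y3}. weight D * weight D) = 18" using X3_neq_Y3 weight_XY by simp
  finally show ?thesis by simp
qed

text \<open>Exchanging one element of \<open>X3\<close> against one of \<open>Y3\<close>, in either
  set, gives nine triples each, all of weight 1. The remaining terms are nonnegative, so it suffices
  that the listed triples are distinct.\<close>

lemma sum_weight_ge:
  assumes g: "\<And>D. g D \<ge> 0"
  shows "3 * g X3 + 3 * g Y3
      + (\<Sum>(i,k)\<in>X3 \<times> Y3. g (insert k (X3 - {i})) + g (insert i (Y3 - {k})))
    \<le> (\<Sum>D\<in>Pow {..<6}. weight D * g D)"
proof -
  let ?F = "\<lambda>(i,k). insert k (X3 - {i})" and ?G = "\<lambda>(i,k). insert i (Y3 - {k})"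
  let ?I = "X3 \<times> Y3"
  have F: "?F x \<inter> Y3 = {snd x}" "X3 - ?F x = {fst x}" "?F x \<subseteq> {..<6}" "card (?F x) = 3" if "x \<in> ?I" for x
    using that by auto
  have G: "?G x \<inter> X3 = {fst x}" "Y3 - ?G x = {snd x}" "?G x \<subseteq> {..<6}" "card (?G x) = 3" if "x \<in> ?I" for x
    using that by auto
  have injF: "inj_on ?F ?I"
  proof (rule inj_onI)
    fix x y assume "x \<in> ?I" "y \<in> ?I" "?F x = ?F y"
    then show "x = y" using F(1,2)[of x] F(1,2)[of y] by (metis prod.expand the_elem_eq)
  qed
  have injG: "inj_on ?G ?I"
  proof (rule inj_onI)
    fix x y assume "x \<in> ?I" "y \<in> ?I" "?G x = ?G y"
    then show "x = y" using G(1,2)[of x] G(1,2)[of y] by (metis prod.expand the_elem_eq)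
  qed
  \<comment> \<open>The size of the intersection with \<open>X3\<close> is 3 at \<open>X3\<close>, 0
    at \<open>Y3\<close>, 2 on the image of \<open>?F\<close> and 1 on that of \<open>?G\<close>,
    which separates the four families.\<close>
  define f where "f D = card (D \<inter> X3)" for D
  have fXY: "f X3 = 3" "f Y3 = 0" by (simp_all add: f_def)
  have fF: "f (?F x) = 2" if "x \<in> ?I" for x using that by (auto simp: f_def)
  have fG: "f (?G x) = 1" if "x \<in> ?I" for x using G(1)[OF that] by (simp add: f_def)
  have ne: "D \<noteq> E" if "f D \<noteq> f E" for D E using that by blast
  have FXY: "?F x \<noteq> X3" "?F x \<noteq> Y3" if "x \<in> ?I" for x
    by (rule ne, use fXY fF[OF that] in linarith)+
  have GXY: "?G x \<noteq> X3" "?G x \<noteq> Y3" if "x \<in> ?I" for x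
    by (rule ne, use fXY fG[OF that] in linarith)+
  have "(\<Sum>D\<in>{X3,Y3} \<union> ?F ` ?I \<union> ?G ` ?I. weight D * g D) \<le> (\<Sum>D\<in>Pow {..<6}. weight D * g D)"
  proof (rule sum_mono2)
    show "{X3,Y3} \<union> ?F ` ?I \<union> ?G ` ?I \<subseteq> Pow {..<6}"
    proof (intro Un_least image_subsetI)
      show "{X3,Y3} \<subseteq> Pow {..<6}" by simp
    qed (simp_all only: Pow_iff F(3) G(3))
    show "0 \<le> weight D * g D" for D using weight_nonneg g by (rule mult_nonneg_nonneg)
  qed simp
  moreover have "(\<Sum>D\<in>{X3,Y3} \<union> ?F ` ?I \<union> ?G ` ?I. weight D * g D)
     = (\<Sum>D\<in>{X3,Y3} \<union> ?F ` ?I. weight D * g D) + (\<Sum>D\<in>?G ` ?I. weight D * g D)"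
  proof (rule sum.union_disjoint)
    have ne1: "f D \<noteq> 1" if "D \<in> {X3,Y3} \<union> ?F ` ?I" for D
      using that by (elim UnE insertE imageE emptyE) (simp_all only: fXY fF, simp_all?)
    show "({X3,Y3} \<union> ?F ` ?I) \<inter> ?G ` ?I = {}"
    proof (rule equals0I, erule IntE)
      fix D assume D: "D \<in> {X3,Y3} \<union> ?F ` ?I" "D \<in> ?G ` ?I"
      from D(2) have "f D = 1" by (elim imageE) (simp only: fG)
      then show False using ne1[OF D(1)] by contradiction
    qed
  qed simp_all
  moreover have "(\<Sum>D\<in>{X3,Y3} \<union> ?F ` ?I. weight D * g D)
     = (\<Sum>D\<in>{X3,Y3}. weight D * g D) + (\<Sum>D\<in>?F ` ?I. weight D * g D)"
  proof (rule sum.union_disjoint)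
    have ne2: "f D \<noteq> 2" if "D \<in> {X3,Y3}" for D
      using that by (elim insertE emptyE) (simp_all only: fXY, simp_all?)
    show "{X3,Y3} \<inter> ?F ` ?I = {}"
    proof (rule equals0I, erule IntE)
      fix D assume D: "D \<in> {X3,Y3}" "D \<in> ?F ` ?I"
      from D(2) have "f D = 2" by (elim imageE) (simp only: fF)
      then show False using ne2[OF D(1)] by contradiction
    qed
  qed simp_all
  moreover have "(\<Sum>D\<in>{X3,Y3}. weight D * g D) = 3 * g X3 + 3 * g Y3"
    using X3_neq_Y3 weight_XY by simp
  moreover have "(\<Sum>D\<in>?F ` ?I. weight D * g D) = (\<Sum>x\<in>?I. g (?F x))"
    unfolding sum.reindex[OF injF] comp_def
    by (intro sum.cong refl) (use F(3,4) FXY in \<open>simp only: weight_def if_True if_False simp_thms mult_1_left\<close>)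
  moreover have "(\<Sum>D\<in>?G ` ?I. weight D * g D) = (\<Sum>x\<in>?I. g (?G x))"
    unfolding sum.reindex[OF injG] comp_def
    by (intro sum.cong refl) (use G(3,4) GXY in \<open>simp only: weight_def if_True if_False simp_thms mult_1_left\<close>)
  moreover have "(\<Sum>(i,k)\<in>?I. g (insert k (X3 - {i})) + g (insert i (Y3 - {k})))
     = (\<Sum>x\<in>?I. g (?F x)) + (\<Sum>x\<in>?I. g (?G x))"
    unfolding sum.distrib[symmetric] by (intro sum.cong refl) auto
  ultimately show ?thesis by linarith
qed

text \<open>Average the three Pluecker relations exchanging \<open>0\<close>, \<open>1\<close> or \<open>2\<close> against \<open>3\<close>, \<open>4\<close>, \<open>5\<close>, then apply
  \<open>2xy \<le> x\<^sup>2 + y\<^sup>2\<close> to every product.\<close>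
lemma weight_minor_bound:
  fixes gs :: "(nat \<Rightarrow> complex) list"
  assumes T: "finite T" "T \<subseteq> {6..}"
  defines "M \<equiv> \<lambda>D. norm (minor gs (D \<union> T))"
  shows "12 * (M X3 * M Y3) \<le> (\<Sum>D\<in>Pow {..<6}. weight D * (M D)\<^sup>2)"
proof -
  have amgm: "2 * (x * y) \<le> x\<^sup>2 + y\<^sup>2" for x y :: real
    using sum_squares_bound[of x y] by simp
  have ex: "M Y3 * M X3 \<le> (\<Sum>k\<in>Y3. M (insert i (Y3 - {k})) * M (insert k (X3 - {i})))" if i: "i \<in> X3" for i
  proof -
    \<comment> \<open>Moving \<open>i\<close> from \<open>?A\<close> to \<open>?R\<close> gives
      \<open>Y3\<close> and \<open>X3\<close>, each joined with \<open>T\<close>. As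
      \<open>T\<close> lies in both sets, only the elements of \<open>Y3\<close> remain as competing
      exchanges.\<close>
    let ?A = "insert i (Y3 \<union> T)" and ?R = "(X3 - {i}) \<union> T"
    have i6: "i < 6" "i \<notin> Y3" using i by auto
    have iT: "i \<notin> T" and YT: "\<And>k. k \<in> Y3 \<Longrightarrow> k \<notin> T" using T i6 by auto
    have "norm (minor gs (?A - {i})) * norm (minor gs (insert i ?R))
      \<le> (\<Sum>j\<in>?A - ?R - {i}. norm (minor gs (?A - {j})) * norm (minor gs (insert j ?R)))"
      using T iT by (intro plucker_bound) auto
    moreover have "?A - {i} = Y3 \<union> T" using iT i6 by auto
    moreover have "insert i ?R = X3 \<union> T" using i by auto
    moreover have "?A - ?R - {i} = Y3"
    proof -
      have "Y3 \<inter> X3 = {}" by auto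
      then show ?thesis using YT i6(2) by blast
    qed
    moreover have "?A - {k} = insert i (Y3 - {k}) \<union> T" if "k \<in> Y3" for k
      using that YT[OF that] i6(2) by blast
    moreover have "insert k ?R = insert k (X3 - {i}) \<union> T" for k by blast
    ultimately show ?thesis unfolding M_def by (simp cong: sum.cong)
  qed
  have "3 * (M X3 * M Y3) = (\<Sum>i\<in>X3. M Y3 * M X3)" by simp
  also have "\<dots> \<le> (\<Sum>i\<in>X3. \<Sum>k\<in>Y3. M (insert i (Y3 - {k})) * M (insert k (X3 - {i})))"
    by (intro sum_mono ex)
  finally have 1: "6 * (M X3 * M Y3)
      \<le> (\<Sum>i\<in>X3. \<Sum>k\<in>Y3. 2 * (M (insert i (Y3 - {k})) * M (insert k (X3 - {i}))))"
    unfolding sum_distrib_left[symmetric] by linarith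
  also have "\<dots> \<le> (\<Sum>i\<in>X3. \<Sum>k\<in>Y3. (M (insert i (Y3 - {k})))\<^sup>2 + (M (insert k (X3 - {i})))\<^sup>2)"
    by (intro sum_mono amgm)
  also have "\<dots> = (\<Sum>(i,k)\<in>X3 \<times> Y3. (M (insert k (X3 - {i})))\<^sup>2 + (M (insert i (Y3 - {k})))\<^sup>2)"
    unfolding sum.cartesian_product by (intro sum.cong refl) auto
  \<comment> \<open>The eighteen exchanged triples account for half of the factor 12; the other half
    is AM-GM for the weights 3 at \<open>X3\<close> and \<open>Y3\<close>.\<close>
  finally show ?thesis
    using sum_weight_ge[of "\<lambda>D. (M D)\<^sup>2"] amgm[of "M X3" "M Y3"] by auto
qed

lemma herm_card:
  assumes "herm D E \<noteq> 0"
  shows "card D = 3 \<and> card E = 3"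
proof (cases "D = X3 \<and> E = Y3 \<or> D = Y3 \<and> E = X3")
  case True
  then show ?thesis by auto
next
  case False
  then have "herm D E = (if D = E then weight D else 0)"
    unfolding herm_def by (simp only: if_False add_0_right)
  then have "D = E" "weight D \<noteq> 0" using assms by metis+
  then show ?thesis by (metis weight_def)
qed

lemma sum_herm:
  fixes k :: "nat set \<Rightarrow> nat set \<Rightarrow> complex"
  shows "(\<Sum>D\<in>Pow {..<6}. \<Sum>E\<in>Pow {..<6}. of_real (herm D E) * k D E)
    = (\<Sum>D\<in>Pow {..<6}. of_real (weight D) * k D D) + 6 * (k X3 Y3 + k Y3 X3)"
proof -
  let ?P = "Pow {..<6::nat}"
  have "of_real (herm D E) * k D E
      = (if E = D then of_real (weight D) * k D D else 0)
        + (if E = Y3 then if D = X3 then 6 * k X3 Y3 else 0 else 0)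
        + (if E = X3 then if D = Y3 then 6 * k Y3 X3 else 0 else 0)" for D E
    using X3_neq_Y3 unfolding herm_def by (cases "D = X3"; cases "D = Y3"; cases "E = X3"; cases "E = Y3") (simp_all add: distrib_right)
  moreover have "X3 \<in> ?P" "Y3 \<in> ?P" "finite ?P" by auto
  ultimately show ?thesis
    by (simp only: sum.distrib sum.delta if_True refl) (simp add: sum.distrib[symmetric] distrib_left)
qed

subsection \<open>The form for general \<open>p\<close>\<close>

text \<open>These index the terms of \<omega>^{p-3} / (p-3)!. They are the subsets of exactly half
  size, so complements in \<open>{6..<2*p}\<close> are again tails.\<close>

definition tails :: "nat \<Rightarrow> nat set set" where
  "tails p = {T. T \<subseteq> {6..<2*p} \<and> card T = p - 3}"

text \<open>The tensor product of \<open>herm\<close> with the identity matrix on tails.\<close>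

definition coef :: "nat \<Rightarrow> nat set \<Rightarrow> nat set \<Rightarrow> real" where
  "coef p A B = (if A - {..<6} = B - {..<6} \<and> A - {..<6} \<in> tails p
     then herm (A \<inter> {..<6}) (B \<inter> {..<6}) else 0)"

text \<open>The factor \<open>sig p\<close> is the normalisation found in
  \<open>wedge_list_i_gamma_gammabar_enc\<close>, so that \<open>coef p\<close> is the Hermitian
  matrix to be compared with vectors of minors.\<close>

definition alpha :: "nat \<Rightarrow> form" where
  "alpha p K = (if K \<subseteq> {..<2*(2*p)}
     then sig p * of_real (coef p (K \<inter> {..<2*p}) (dec (2*p) K)) else 0)"

lemma alpha_enc:
  assumes "A \<subseteq> {..<2*p}" "B \<subseteq> {..<2*p}"
  shows "alpha p (enc (2*p) A B) = sig p * of_real (coef p A B)"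
  using enc_subset[OF assms]
  by (simp only: alpha_def if_True enc_Int_low[OF assms(1)] dec_enc[OF assms(1)])

lemma coef_card:
  assumes p: "p \<ge> 3" and nz: "coef p A B \<noteq> 0" and fin: "finite A" "finite B"
  shows "card A = p" "card B = p"
proof -
  have h: "herm (A \<inter> {..<6}) (B \<inter> {..<6}) \<noteq> 0" and t: "A - {..<6} = B - {..<6}" "A - {..<6} \<in> tails p"
    using nz by (auto simp: coef_def split: if_splits)
  have "card (A \<inter> {..<6}) = 3" "card (B \<inter> {..<6}) = 3" using herm_card[OF h] by blast+
  moreover have "card (A - {..<6}) = p - 3" "card (B - {..<6}) = p - 3" using t by (auto simp: tails_def)
  ultimately show "card A = p" "card B = p"
    using card_Int_Diff[OF fin(1), of "{..<6}"] card_Int_Diff[OF fin(2), of "{..<6}"] p by auto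
qed

lemma is_pq_form_alpha:
  assumes "p \<ge> 3"
  shows "is_pq_form (2*p) p p (alpha p)"
proof (rule is_pq_form_encI)
  fix A B :: "nat set"
  assume AB: "A \<subseteq> {..<2*p}" "B \<subseteq> {..<2*p}" "alpha p (enc (2*p) A B) \<noteq> 0"
  then have "coef p A B \<noteq> 0" by (auto simp: alpha_enc)
  then show "card A = p \<and> card B = p"
    using coef_card[OF assms] AB finite_subset[of _ "{..<2*p}"] by blast
qed (auto simp: alpha_def split: if_splits)

section \<open>Top-degree products with \<open>alpha\<close>\<close>

abbreviation split_sign :: "nat \<Rightarrow> nat set \<Rightarrow> complex" where
  "split_sign n A \<equiv> (-1) ^ invs A ({..<n} - A)"

text \<open>The two factors \<open>sig p\<close> cancel the crossing sign of the (p,p)-forms,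
  leaving a signed pairing of the matrix of \<open>alpha\<close> with \<open>b\<close> at
  complementary sets. The hypothesis on \<open>g\<close> covers both products of
  \<open>i_gamma_gammabar\<close> and \<open>alpha\<close> itself.\<close>

lemma wedge_alpha_top:
  assumes p: "p \<ge> 3"
    and g: "\<And>A B. A \<subseteq> {..<2*p} \<Longrightarrow> B \<subseteq> {..<2*p} \<Longrightarrow> g (enc (2*p) A B) = sig p * b A B"
  shows "wedge (alpha p) g {..<2*(2*p)} = (\<Sum>A\<in>Pow {..<2*p}. \<Sum>B\<in>Pow {..<2*p}.
    split_sign (2*p) A * split_sign (2*p) B * of_real (coef p A B) * b ({..<2*p} - A) ({..<2*p} - B))"
  unfolding enc_full[of "2*p", symmetric] wedge_enc[OF subset_refl subset_refl]
proof (intro sum.cong refl)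
  fix A B assume "A \<in> Pow {..<2*p}" "B \<in> Pow {..<2*p}"
  then have AB: "A \<subseteq> {..<2*p}" "B \<subseteq> {..<2*p}" by auto
  then have fin: "finite A" "finite B" using finite_subset by blast+
  show "(-1) ^ (invs A ({..<2*p} - A) + invs B ({..<2*p} - B) + card B * card ({..<2*p} - A))
      * alpha p (enc (2*p) A B) * g (enc (2*p) ({..<2*p} - A) ({..<2*p} - B))
    = split_sign (2*p) A * split_sign (2*p) B * of_real (coef p A B) * b ({..<2*p} - A) ({..<2*p} - B)"
  proof (cases "coef p A B = 0")
    case True
    then show ?thesis using AB by (simp add: alpha_enc)
  next
    case False
    then have c: "card A = p" "card B = p" using coef_card[OF p] fin by auto
    then have "card ({..<2*p} - A) = p" using AB fin by (simp add: card_Diff_subset)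
    moreover have "(-1) ^ (p * p) * (sig p * sig p) = 1"
      unfolding sig_square by (simp add: power_add[symmetric])
    ultimately show ?thesis using AB c
      by (simp add: alpha_enc g power_add)
  qed
qed

lemma sum_Pow_split:
  assumes "m \<le> n"
  shows "(\<Sum>A\<in>Pow {..<n::nat}. f A) = (\<Sum>T\<in>Pow {m..<n}. \<Sum>D\<in>Pow {..<m}. f (D \<union> T))"
proof -
  have "bij_betw (\<lambda>(T,D). D \<union> T) (Pow {m..<n} \<times> Pow {..<m}) (Pow {..<n})"
    by (rule bij_betw_byWitness[where f' = "\<lambda>A. (A - {..<m}, A \<inter> {..<m})"]) (use assms in \<open>auto 4 3\<close>)
  from sum.reindex_bij_betw[OF this, of f, symmetric] show ?thesis
    by (simp add: sum.cartesian_product case_prod_unfold)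
qed

lemma coef_Un:
  assumes "D \<subseteq> {..<6}" "E \<subseteq> {..<6}" "T \<subseteq> {6..<2*p}" "U \<subseteq> {6..<2*p}"
  shows "coef p (D \<union> T) (E \<union> U) = (if U = T then if T \<in> tails p then herm D E else 0 else 0)"
proof -
  have "(D \<union> T) - {..<6} = T" "(E \<union> U) - {..<6} = U" "(D \<union> T) \<inter> {..<6} = D" "(E \<union> U) \<inter> {..<6} = E"
    using assms by auto
  then show ?thesis by (auto simp: coef_def)
qed

lemma compl_Un:
  fixes p :: nat
  assumes "D \<subseteq> {..<6}" "T \<subseteq> {6..<2*p}" "p \<ge> 3"
  shows "{..<2*p} - (D \<union> T) = ({..<6} - D) \<union> ({6..<2*p} - T)"
proof -
  have "{..<2*p} = {..<6} \<union> {6..<2*p}" using assms(3) by auto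
  moreover have "D \<inter> {6..<2*p} = {}" "T \<inter> {..<6} = {}" using assms by auto
  ultimately show ?thesis by blast
qed

text \<open>The tail contributes equally to both exponents, since its inversions with low indices
  depend only on how many of these there are. The exponents thus differ by the 9 inversions of
  \<open>Y3\<close> with \<open>X3\<close>, an odd number; this is the source of the negative
  square.\<close>

lemma split_sign_XY:
  assumes T: "T \<in> tails p" and p: "p \<ge> 3"
  shows "split_sign (2*p) (X3 \<union> T) * split_sign (2*p) (Y3 \<union> T) = -1"
proof -
  have Ts: "T \<subseteq> {6..<2*p}" using T by (simp add: tails_def)
  have fin: "finite T" using Ts finite_subset by blast
  let ?T = "{6..<2*p} - T"
  have "invs (D \<union> T) (E \<union> ?T) = invs D E + (card T * card E + invs T ?T)"
    if "D \<subseteq> {..<6}" "E \<subseteq> {..<6}" for D E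
  proof -
    have "finite D" using that finite_subset by blast
    moreover have "D \<inter> T = {}" "E \<inter> ?T = {}" using that Ts by fastforce+
    moreover have "invs D ?T = 0" using that by (intro invs_eq_0) auto
    moreover have "invs T E = card T * card E" using that Ts by (intro invs_eq_mult) force
    ultimately show ?thesis using fin by (simp add: invs_Un_left invs_Un_right)
  qed
  note this[of X3 Y3, OF X3_subset Y3_subset] this[of Y3 X3, OF Y3_subset X3_subset]
  moreover have "{..<2*p} - (X3 \<union> T) = Y3 \<union> ?T" "{..<2*p} - (Y3 \<union> T) = X3 \<union> ?T"
    using compl_Un[OF X3_subset Ts p] compl_Un[OF Y3_subset Ts p] compl_X3 compl_Y3 by simp_all
  moreover have "invs X3 Y3 = 0" by (rule invs_eq_0) auto
  moreover have "invs Y3 X3 = card Y3 * card X3" by (rule invs_eq_mult) auto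
  moreover have "card X3 = 3" "card Y3 = 3" by simp_all
  ultimately have "invs (X3 \<union> T) ({..<2*p} - (X3 \<union> T)) = card T * 3 + invs T ?T"
    "invs (Y3 \<union> T) ({..<2*p} - (Y3 \<union> T)) = 9 + (card T * 3 + invs T ?T)"
    by simp_all
  then show ?thesis by (simp only: power_add) (simp add: mult_ac power_mult_distrib[symmetric])
qed

text \<open>Since \<open>coef\<close> vanishes for different tails, the pairing splits into one
  computation of the case p = 3 for each tail. Signs square to 1 on the diagonal and multiply to -1
  off it.\<close>

lemma wedge_alpha_top_eq:
  assumes p: "p \<ge> 3"
    and g: "\<And>A B. A \<subseteq> {..<2*p} \<Longrightarrow> B \<subseteq> {..<2*p} \<Longrightarrow> g (enc (2*p) A B) = sig p * b A B"
  shows "wedge (alpha p) g {..<2*(2*p)} = (\<Sum>T\<in>tails p.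
    (\<Sum>D\<in>Pow {..<6}. of_real (weight D) * b (({..<6} - D) \<union> ({6..<2*p} - T)) (({..<6} - D) \<union> ({6..<2*p} - T)))
    - 6 * (b (Y3 \<union> ({6..<2*p} - T)) (X3 \<union> ({6..<2*p} - T)) + b (X3 \<union> ({6..<2*p} - T)) (Y3 \<union> ({6..<2*p} - T))))"
proof -
  let ?c = "\<lambda>D T. ({..<6} - D) \<union> ({6..<2*p} - T)"
  let ?s = "\<lambda>D T. split_sign (2*p) (D \<union> T)"
  have p6: "6 \<le> 2*p" using p by simp
  have "wedge (alpha p) g {..<2*(2*p)}
    = (\<Sum>T\<in>Pow {6..<2*p}. \<Sum>D\<in>Pow {..<6}. \<Sum>U\<in>Pow {6..<2*p}. \<Sum>E\<in>Pow {..<6}.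
       ?s D T * ?s E U * of_real (coef p (D \<union> T) (E \<union> U))
         * b ({..<2*p} - (D \<union> T)) ({..<2*p} - (E \<union> U)))"
    using wedge_alpha_top[where b = b, OF p g] unfolding sum_Pow_split[OF p6] .
  also have "\<dots> = (\<Sum>T\<in>Pow {6..<2*p}. \<Sum>D\<in>Pow {..<6}. \<Sum>U\<in>Pow {6..<2*p}.
       if U = T then if T \<in> tails p then \<Sum>E\<in>Pow {..<6}. of_real (herm D E) * (?s D T * ?s E T * b (?c D T) (?c E T)) else 0 else 0)"
  proof (intro sum.cong refl)
    fix T D U :: "nat set"
    assume "T \<in> Pow {6..<2*p}" "D \<in> Pow {..<6}" "U \<in> Pow {6..<2*p}"
    then have T: "T \<subseteq> {6..<2*p}" and D: "D \<subseteq> {..<6}" and U: "U \<subseteq> {6..<2*p}" by auto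
    have t: "?s D T * ?s E U * of_real (coef p (D \<union> T) (E \<union> U)) * b ({..<2*p} - (D \<union> T)) ({..<2*p} - (E \<union> U))
      = (if U = T then if T \<in> tails p then of_real (herm D E) * (?s D T * ?s E T * b (?c D T) (?c E T)) else 0 else 0)"
      if "E \<in> Pow {..<6}" for E
    proof -
      have E: "E \<subseteq> {..<6}" using that by auto
      show ?thesis unfolding coef_Un[OF D E T U] compl_Un[OF D T p, symmetric] compl_Un[OF E T p, symmetric] by simp
    qed
    show "(\<Sum>E\<in>Pow {..<6}. ?s D T * ?s E U * of_real (coef p (D \<union> T) (E \<union> U))
        * b ({..<2*p} - (D \<union> T)) ({..<2*p} - (E \<union> U)))
      = (if U = T then if T \<in> tails p then \<Sum>E\<in>Pow {..<6}. of_real (herm D E) * (?s D T * ?s E T * b (?c D T) (?c E T)) else 0 else 0)"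
      by (rule trans[OF sum.cong[OF refl t]]) simp_all
  qed
  also have "\<dots> = (\<Sum>T\<in>Pow {6..<2*p}. if T \<in> tails p then
       \<Sum>D\<in>Pow {..<6}. \<Sum>E\<in>Pow {..<6}. of_real (herm D E) * (?s D T * ?s E T * b (?c D T) (?c E T)) else 0)"
    by (intro sum.cong refl) (simp add: sum.delta)
  also have "\<dots> = (\<Sum>T\<in>tails p. \<Sum>D\<in>Pow {..<6}. \<Sum>E\<in>Pow {..<6}.
       of_real (herm D E) * (?s D T * ?s E T * b (?c D T) (?c E T)))"
  proof -
    have "tails p \<subseteq> Pow {6..<2*p}" by (auto simp: tails_def)
    then show ?thesis by (subst sum.inter_restrict[symmetric]) (auto simp: Int_absorb1)
  qed
  also have "\<dots> = (\<Sum>T\<in>tails p. (\<Sum>D\<in>Pow {..<6}. of_real (weight D) * b (?c D T) (?c D T))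
    - 6 * (b (Y3 \<union> ({6..<2*p} - T)) (X3 \<union> ({6..<2*p} - T)) + b (X3 \<union> ({6..<2*p} - T)) (Y3 \<union> ({6..<2*p} - T))))"
  proof (intro sum.cong refl)
    fix T assume T: "T \<in> tails p"
    have s: "?s X3 T * ?s Y3 T = -1" "?s Y3 T * ?s X3 T = -1"
      using split_sign_XY[OF T p] by (simp_all only: mult.commute)
    have "?s D T * ?s D T = 1" for D by (simp add: power_add[symmetric])
    then show "(\<Sum>D\<in>Pow {..<6}. \<Sum>E\<in>Pow {..<6}. of_real (herm D E) * (?s D T * ?s E T * b (?c D T) (?c E T)))
      = (\<Sum>D\<in>Pow {..<6}. of_real (weight D) * b (?c D T) (?c D T))
        - 6 * (b (Y3 \<union> ({6..<2*p} - T)) (X3 \<union> ({6..<2*p} - T)) + b (X3 \<union> ({6..<2*p} - T)) (Y3 \<union> ({6..<2*p} - T)))"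
      unfolding sum_herm s compl_X3 compl_Y3 by (simp only:) (simp add: algebra_simps)
  qed
  finally show ?thesis .
qed

lemma tails_compl:
  assumes "T \<in> tails p" "p \<ge> 3"
  shows "{6..<2*p} - T \<in> tails p"
  using assms by (auto simp: tails_def card_Diff_subset finite_subset[of T "{6..<2*p}"])

lemma sum_Pow_compl: "(\<Sum>D\<in>Pow S. f (S - D)) = (\<Sum>D\<in>Pow S. f D)"
  by (rule sum.reindex_bij_witness[of _ "\<lambda>D. S - D" "\<lambda>D. S - D"]) auto

lemma sum_weight_compl:
  "(\<Sum>D\<in>Pow {..<6}. weight D * f ({..<6} - D)) = (\<Sum>D\<in>Pow {..<6}. weight D * f D)"
proof -
  have "(\<Sum>D\<in>Pow {..<6}. weight D * f ({..<6} - D)) = (\<Sum>D\<in>Pow {..<6}. weight ({..<6} - D) * f ({..<6} - D))"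
    by (intro sum.cong refl) (auto simp: weight_compl)
  then show ?thesis using sum_Pow_compl[of "\<lambda>D. weight D * f D" "{..<6}"] by simp
qed

section \<open>Positivity and the negative square\<close>

lemma positive_form_alpha:
  assumes p: "p \<ge> 3"
  shows "positive_form (2*p) p (alpha p)"
  unfolding positive_form_def nonneg_top_def
proof (intro allI impI)
  fix gs :: "(nat \<Rightarrow> complex) list"
  assume "length gs = 2 * p - p"
  then have len: "length gs = p" by simp
  let ?w = "wedge_list (map (i_gamma_gammabar (2*p)) gs)"
  let ?m = "minor gs"
  have top: "wedge (alpha p) ?w = scale_form (wedge (alpha p) ?w {..<2*(2*p)}) (dV (2*p))"
    using wedge_top_degree[OF is_pq_form_alpha[OF p]] is_pq_form_wedge_list[of "2*p" gs] len by simp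
  \<comment> \<open>The value of the p = 3 Hermitian form with negated off-diagonal entries at the
    minors with tail \<open>T\<close>. The bound on the product is one of absolute values, so the
    negation does no harm.\<close>
  define q where "q T = (\<Sum>D\<in>Pow {..<6}. weight D * (norm (?m (D \<union> T)))\<^sup>2)
      - 12 * Re (?m (X3 \<union> T) * cnj (?m (Y3 \<union> T)))" for T
  have "wedge (alpha p) ?w {..<2*(2*p)} = of_real (\<Sum>T\<in>tails p. q ({6..<2*p} - T))"
  proof -
    have g: "?w (enc (2*p) A B) = sig p * (?m A * cnj (?m B))" if "A \<subseteq> {..<2*p}" "B \<subseteq> {..<2*p}" for A B
      using wedge_list_i_gamma_gammabar_enc[OF that, of gs] len by simp
    have sq: "z * cnj z = of_real ((norm z)\<^sup>2)" for z using complex_norm_square[of z] by simp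
    have re: "y * cnj x + x * cnj y = of_real (2 * Re (x * cnj y))" for x y :: complex
      by (simp add: complex_eq_iff)
    have qT: "(\<Sum>D\<in>Pow {..<6}. of_real (weight D) * (?m (({..<6} - D) \<union> T) * cnj (?m (({..<6} - D) \<union> T))))
        - 6 * (?m (Y3 \<union> T) * cnj (?m (X3 \<union> T)) + ?m (X3 \<union> T) * cnj (?m (Y3 \<union> T))) = of_real (q T)" for T
    proof -
      have "(\<Sum>D\<in>Pow {..<6}. complex_of_real (weight D) * (?m (({..<6} - D) \<union> T) * cnj (?m (({..<6} - D) \<union> T))))
         = of_real (\<Sum>D\<in>Pow {..<6}. weight D * (norm (?m (({..<6} - D) \<union> T)))\<^sup>2)"
        unfolding sq by simp
      also have "\<dots> = of_real (\<Sum>D\<in>Pow {..<6}. weight D * (norm (?m (D \<union> T)))\<^sup>2)"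
        using sum_weight_compl[of "\<lambda>D. (norm (?m (D \<union> T)))\<^sup>2"] by simp
      finally show ?thesis unfolding re q_def by simp
    qed
    show ?thesis
      using wedge_alpha_top_eq[where b = "\<lambda>A B. ?m A * cnj (?m B)", OF p g] unfolding qT by simp
  qed
  moreover have "q ({6..<2*p} - T) \<ge> 0" for T
  proof -
    let ?T = "{6..<2*p} - T"
    have "Re (?m (X3 \<union> ?T) * cnj (?m (Y3 \<union> ?T))) \<le> norm (?m (X3 \<union> ?T)) * norm (?m (Y3 \<union> ?T))"
      using complex_Re_le_cmod[of "?m (X3 \<union> ?T) * cnj (?m (Y3 \<union> ?T))"] by (simp only: norm_mult complex_mod_cnj)
    moreover have "finite ?T" "?T \<subseteq> {6..}" by auto
    note weight_minor_bound[OF this, of gs]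
    ultimately show ?thesis unfolding q_def by linarith
  qed
  ultimately show "\<exists>c\<ge>0. wedge (alpha p) ?w = scale_form (complex_of_real c) (dV (2*p))"
    using top by (metis sum_nonneg)
qed

text \<open>Complements of tails are tails and \<open>weight\<close> is invariant under complements,
  so each tail contributes 36 - 6 * (6 + 6) = -36.\<close>

lemma wedge_alpha_alpha:
  assumes p: "p \<ge> 3"
  shows "wedge (alpha p) (alpha p) = scale_form (of_real (- 36 * real (card (tails p)))) (dV (2*p))"
proof -
  note wedge_alpha_top_eq[where b = "\<lambda>A B. of_real (coef p A B)", OF p alpha_enc]
  also have "(\<Sum>T\<in>tails p.
      (\<Sum>D\<in>Pow {..<6}. complex_of_real (weight D)
        * of_real (coef p (({..<6} - D) \<union> ({6..<2*p} - T)) (({..<6} - D) \<union> ({6..<2*p} - T))))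
      - 6 * (of_real (coef p (Y3 \<union> ({6..<2*p} - T)) (X3 \<union> ({6..<2*p} - T)))
        + of_real (coef p (X3 \<union> ({6..<2*p} - T)) (Y3 \<union> ({6..<2*p} - T))))) = (\<Sum>T\<in>tails p. - 36)"
  proof (intro sum.cong refl)
    fix T assume T: "T \<in> tails p"
    let ?T = "{6..<2*p} - T"
    have c: "coef p (D \<union> ?T) (E \<union> ?T) = herm D E" if "D \<subseteq> {..<6}" "E \<subseteq> {..<6}" for D E
      using tails_compl[OF T p] coef_Un[OF that, of ?T p ?T] by auto
    have d: "herm D D = weight D" for D
      using X3_neq_Y3 unfolding herm_def by auto
    have XY: "herm X3 Y3 = 6" "herm Y3 X3 = 6" using X3_neq_Y3 unfolding herm_def by auto
    have "(\<Sum>D\<in>Pow {..<6}. complex_of_real (weight D) * of_real (coef p (({..<6} - D) \<union> ?T) (({..<6} - D) \<union> ?T)))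
       = (\<Sum>D\<in>Pow {..<6}. of_real (weight D * weight D))"
      by (intro sum.cong refl) (auto simp: c d weight_compl)
    also have "\<dots> = of_real 36" using sum_weight_square by (metis of_real_sum)
    finally show "(\<Sum>D\<in>Pow {..<6}. complex_of_real (weight D) * of_real (coef p (({..<6} - D) \<union> ?T) (({..<6} - D) \<union> ?T)))
       - 6 * (of_real (coef p (Y3 \<union> ?T) (X3 \<union> ?T)) + of_real (coef p (X3 \<union> ?T) (Y3 \<union> ?T))) = - 36"
      unfolding c[OF X3_subset Y3_subset] c[OF Y3_subset X3_subset] XY by simp
  qed
  finally have "wedge (alpha p) (alpha p) {..<2*(2*p)} = of_real (- 36 * real (card (tails p)))"
    by simp
  then show ?thesis
    using wedge_top_degree[OF is_pq_form_alpha[OF p] is_pq_form_alpha[OF p]] by metis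
qed

text \<open>The number of tails is the binomial coefficient of \<open>2*p - 6\<close> over
  \<open>p - 3\<close>; its positivity makes the square strictly negative.\<close>

lemma card_tails_pos:
  assumes "p \<ge> 3"
  shows "card (tails p) > 0"
  unfolding tails_def using n_subsets[of "{6..<2*p}" "p - 3"] assms by simp

theorem theorem2:
  fixes p :: nat
  assumes "p \<ge> 3"
  shows "\<exists>\<alpha> :: form. is_pq_form (2*p) p p \<alpha> \<and> positive_form (2*p) p \<alpha> \<and>
           (\<exists>c::real. c < 0 \<and> wedge \<alpha> \<alpha> = scale_form (complex_of_real c) (dV (2*p)))"
proof (intro exI conjI)
  show "is_pq_form (2*p) p p (alpha p)" using assms by (rule is_pq_form_alpha)
  show "positive_form (2*p) p (alpha p)" using assms by (rule positive_form_alpha)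
  show "- 36 * real (card (tails p)) < 0" using card_tails_pos[OF assms] by simp
  show "wedge (alpha p) (alpha p) = scale_form (of_real (- 36 * real (card (tails p)))) (dV (2*p))"
    using assms by (rule wedge_alpha_alpha)
qed

end
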